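(* Let $p_s,p_e>0$ and $\lambda>1$ be real numbers, let $F_s$ be the cumulative distribution function of the renewable generation, a continuous strictly increasing bijection from $[s_{min},s_{max}]$ onto $[0,1]$, and let $\pi(q)=\exp(-(-\log q)^{\gamma})$ for $q\in(0,1]$, $\pi(0)=0$, with $\gamma\in(0,1)$. If $p_s<\frac{p_e}{e}$ (where $e$ is Euler's number), then $$F_s^{-1}\!\left(\pi^{-1}\!\left(\frac{p_s}{\lambda p_e}\right)\right)<F_s^{-1}\!\left(\frac{p_s}{p_e}\right).$$
   Context: Here $p_s$ is a day-ahead sell-back price, $p_e$ a penalty price per unit shortfall, $\lambda>1$ a loss-aversion coefficient, and $\pi$ a probability weighting function, which is a continuous strictly increasing bijection of $[0,1]$ onto itself, so that $\pi^{-1}$ is defined on $[0,1]$. Up to a common additive constant, the left-hand side is the optimal contract amount of a prosumer under prospect theory and the right-hand side the one under expected utility theory. *)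

theory Defs
  imports "HOL-Probability.Probability"
begin

(* Prelec's probability weighting function; it is only meant for arguments q in [0,1]. *)
definition prelec_weight :: "real \<Rightarrow> real \<Rightarrow> real" where
  "prelec_weight \<gamma> q = (if q = 0 then 0 else exp (- ((- ln q) powr \<gamma>)))"

end

theory Submission
  imports Defs
begin

lemma strict_mono_on_prelec_weight:
  assumes "0 < \<gamma>"
  shows "strict_mono_on {0..1} (prelec_weight \<gamma>)"
proof (rule strict_mono_onI)
  fix x y :: real
  assume "x \<in> {0..1}" "y \<in> {0..1}" "x < y"
  then show "prelec_weight \<gamma> x < prelec_weight \<gamma> y"
    using assms by (auto simp: prelec_weight_def intro!: powr_less_mono2)
qed

text \<open>The explicit inverse of the weight on the half-open interval from 0 to 1: the exponents
  \<open>1 / \<gamma>\<close> and \<open>\<gamma>\<close> cancel, and \<open>q \<le> 1\<close> makes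
  \<open>- ln q\<close> nonnegative, so that \<open>(- ln q) powr 1\<close> is \<open>- ln q\<close>
  itself.\<close>

lemma prelec_weight_exp:
  assumes "0 < \<gamma>" "0 < q" "q \<le> 1"
  shows "prelec_weight \<gamma> (exp (- ((- ln q) powr (1 / \<gamma>)))) = q"
  using assms by (simp add: prelec_weight_def powr_powr)

text \<open>Below the fixed point \<open>exp (-1)\<close> the weight overestimates probabilities: there
  \<open>- ln q > 1\<close>, so raising it to the power \<open>1 / \<gamma> > 1\<close> increases it.\<close>

lemma the_inv_into_prelec_weight_less:
  assumes "0 < \<gamma>" "\<gamma> < 1" "0 < q" "q < exp (-1)"
  shows "the_inv_into {0..1} (prelec_weight \<gamma>) q \<in> {0<..<q}"
proof -
  let ?x = "exp (- ((- ln q) powr (1 / \<gamma>)))"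
  have ln: "ln q < -1"
    using assms(3,4) by (metis exp_gt_zero ln_exp ln_less_cancel_iff)
  then have "q \<le> 1"
    using assms(3) by (smt (verit) ln_gt_zero)
  \<comment> \<open>\<open>?x\<close> lies in the unit interval and is mapped to \<open>q\<close>;
    injectivity, from strict monotonicity, identifies it as the inverse value.\<close>
  then have "the_inv_into {0..1} (prelec_weight \<gamma>) q = ?x"
    using assms prelec_weight_exp[OF assms(1,3)]
    by (intro the_inv_into_f_eq strict_mono_on_imp_inj_on strict_mono_on_prelec_weight) auto
  moreover have "(- ln q) powr 1 < (- ln q) powr (1 / \<gamma>)"
    using ln assms(1,2) by (intro powr_less_mono) auto
  then have "?x < exp (ln q)"
    using ln by simp
  ultimately show ?thesis
    using assms(3) by simp
qed

text \<open>As the domain is linearly ordered, the only alternatives are equality and the reverse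
  order, and applying \<open>f\<close> to either contradicts \<open>x < y\<close>.\<close>

lemma the_inv_into_strict_mono:
  fixes f :: "'a :: linorder \<Rightarrow> 'b :: preorder"
  assumes "strict_mono_on A f" "bij_betw f A B" "x \<in> B" "y \<in> B" "x < y"
  shows "the_inv_into A f x < the_inv_into A f y"
proof -
  have "f (the_inv_into A f x) < f (the_inv_into A f y)"
    using assms f_the_inv_into_f_bij_betw[of f A B] by simp
  moreover have "the_inv_into A f x \<in> A" "the_inv_into A f y \<in> A"
    using assms bij_betw_the_inv_into[of f A B] by (auto dest: bij_betwE)
  ultimately show ?thesis
    using assms(1) by (metis less_asym less_irrefl linorder_neqE strict_mono_onD)
qed

theorem corollary1:
  fixes M :: "'a measure" and S :: "'a \<Rightarrow> real" and F\<^sub>s :: "real \<Rightarrow> real"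
    and p\<^sub>s p\<^sub>e lam \<gamma> smin smax :: real
  assumes "p\<^sub>s > 0" and "p\<^sub>e > 0" and "lam > 1" and "0 < \<gamma>" and "\<gamma> < 1"
    and "prob_space M" and "S \<in> borel_measurable M"
    and "F\<^sub>s = cdf (distr M borel S)"
    and "continuous_on {smin..smax} F\<^sub>s"
    and "strict_mono_on {smin..smax} F\<^sub>s"
    and "bij_betw F\<^sub>s {smin..smax} {0..1}"
    and "p\<^sub>s < p\<^sub>e / exp 1"
  shows "the_inv_into {smin..smax} F\<^sub>s (the_inv_into {0..1} (prelec_weight \<gamma>) (p\<^sub>s / (lam * p\<^sub>e)))
    < the_inv_into {smin..smax} F\<^sub>s (p\<^sub>s / p\<^sub>e)"
proof -
  let ?q = "p\<^sub>s / (lam * p\<^sub>e)" and ?r = "p\<^sub>s / p\<^sub>e"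
  let ?w = "the_inv_into {0..1} (prelec_weight \<gamma>) ?q"
  have "?q < ?r" "0 < ?q"
    using assms(1-3) by (simp_all add: field_simps)
  \<comment> \<open>The price condition says exactly that the ratio lies below the fixed point of
    the weight; the smaller \<open>?q\<close> then does too.\<close>
  moreover have "?r < exp (-1)"
    using assms(2,12) by (simp add: field_simps exp_minus)
  moreover have "exp (-1 :: real) < 1"
    by simp
  ultimately have r: "0 \<le> ?r" "?r \<le> 1" and q: "0 < ?q" "?q < exp (-1)" "?q < ?r"
    by linarith+
  \<comment> \<open>Weighting lowers the quantile level from \<open>?q\<close> to \<open>?w\<close>,
    after loss aversion has lowered it from \<open>?r\<close> to \<open>?q\<close>. Positivity of
    \<open>?w\<close> keeps it in the range of \<open>F\<^sub>s\<close>.\<close>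
  have "0 < ?w" "?w < ?q"
    using the_inv_into_prelec_weight_less[OF assms(4,5) q(1,2)] by simp_all
  then show ?thesis
    using the_inv_into_strict_mono[OF assms(10,11), of ?w ?r] q(3) r by simp
qed

end
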